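(* Let $\mathcal V$ be a completely distributive quantale and let $U$ and $P$ be the ultrafilter and powerset monads extended to $\mathcal V$-relations. Let $A=(A,\alpha)$ and $B=(B,\beta)$ be $(U,\mathcal V)$-graphs, with induced $\mathcal V$-valued preclosure space structures $\delta(S,x)=\sup_{\mathfrak x\in UA,\,S\in\mathfrak x}\alpha(\mathfrak x,x)$ on $A$ and $\zeta(T,y)=\sup_{\mathfrak y\in UB,\,T\in\mathfrak y}\beta(\mathfrak y,y)$ on $B$. For a $\mathcal V$-relation $J\colon A\nrightarrow B$ the following hold: (a) if $J$ is $U$-open as a $\mathcal V$-relation of $(U,\mathcal V)$-graphs then it is $P$-open as a $\mathcal V$-relation $J\colon(A,\delta)\nrightarrow(B,\zeta)$ of $\mathcal V$-valued preclosure spaces; (b) if $J$ is $U$-closed as a $\mathcal V$-relation of $(U,\mathcal V)$-graphs then it is both $U$-compact and $P$-closed as a $\mathcal V$-relation $J\colon(A,\delta)\nrightarrow(B,\zeta)$ of $\mathcal V$-valued preclosure spaces. The converse of (a) holds as soon as $B$ is unitary and $U(UJ\odot\beta)=U^2J\odot U\beta$; the converse of (b) holds whenever $A$ is a $(U,\mathcal V)$-category and $U(\alpha\odot J)=U\alpha\odot UJ$.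
   Context: A quantale $\mathcal V=(\mathcal V,\otimes,k)$ is a complete lattice with a (not necessarily commutative) monoid structure $\otimes$ with unit $k$ such that $\otimes$ preserves suprema in each variable; $\bot$ is its bottom element. It is completely distributive if the map $\sup$ from the set of downsets of $\mathcal V$ (ordered by inclusion) to $\mathcal V$ has a left adjoint. A $\mathcal V$-relation $J\colon A\nrightarrow B$ is a function $J\colon A\times B\to\mathcal V$; composition is $(J\odot H)(x,z)=\sup_yJ(x,y)\otimes H(y,z)$, and $\mathcal V$-relations are ordered pointwise. $PA$ is the powerset of $A$ and $UA$ its set of ultrafilters. $\iota_A(x)$ is the principal ultrafilter on $x$; for $\mathfrak X\in U^2A$, $\mu_A(\mathfrak X)=\{S\subseteq A\mid S^\sharp\in\mathfrak X\}$ where $S^\sharp=\{\mathfrak x\in UA\mid S\in\mathfrak x\}$. For $J\colon A\nrightarrow B$ put $(PJ)(S,T)=\inf_{t\in T}\sup_{s\in S}J(s,t)$ and $(UJ)(\mathfrak x,\mathfrak y)=\inf_{S\in\mathfrak x,T\in\mathfrak y}\sup_{s\in S,t\in T}J(s,t)$. A $(U,\mathcal V)$-graph is a set $A$ with $\alpha\colon UA\nrightarrow A$ such that $k\le\alpha(\iota_A(x),x)$ for all $x$. It is unitary if $(U\alpha)(\mathfrak X,\iota_A(x))\le\alpha(\mu_A(\mathfrak X),x)$ for all $\mathfrak X\in U^2A$, $x\in A$ (right unitarity; left unitarity is automatic). It is a $(U,\mathcal V)$-category if $(U\alpha\odot\alpha)(\mathfrak X,x)\le\alpha(\mu_A(\mathfrak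 X),x)$ for all $\mathfrak X\in U^2A$, $x\in A$. A $\mathcal V$-valued preclosure space is a set $A$ with $\delta\colon PA\nrightarrow A$ such that $k\le\delta(\{x\},x)$ for all $x$, and $S\subseteq T$ implies $\delta(S,x)\le\delta(T,x)$. $J\colon(A,\alpha)\nrightarrow(B,\beta)$ is $U$-open if $\alpha\odot J\le UJ\odot\beta$ and $U$-closed if $UJ\odot\beta\le\alpha\odot J$. $J\colon(A,\delta)\nrightarrow(B,\zeta)$ is $P$-open if $\delta\odot J\le PJ\odot\zeta$ and $P$-closed if $PJ\odot\zeta\le\delta\odot J$. $J$ is $U$-compact (with respect to $\alpha$) if $(UJ)(\mathfrak x,\iota_B(y))\le(\alpha\odot J)(\mathfrak x,y)$, i.e. $\inf_{S\in\mathfrak x}\sup_{s\in S}J(s,y)\le\sup_{x\in A}\alpha(\mathfrak x,x)\otimes J(x,y)$, for all $\mathfrak x\in UA$, $y\in B$. *)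

theory Defs imports Main
begin

class quantale = complete_lattice + monoid_mult +
  assumes times_Sup: "x * Sup Y = (SUP y\<in>Y. x * y)"
    and Sup_times: "Sup X * y = (SUP x\<in>X. x * y)"

definition (in order) downset :: "'a set \<Rightarrow> bool" where
  "downset D \<longleftrightarrow> (\<forall>x\<in>D. \<forall>y. y \<le> x \<longrightarrow> y \<in> D)"

text \<open>Monotonicity of the left adjoint \<open>L\<close> is a consequence of the adjunction.\<close>

class completely_distributive_quantale = quantale +
  assumes Sup_left_adjoint:
    "\<exists>L :: 'a \<Rightarrow> 'a set. (\<forall>v. downset (L v)) \<and>
       (\<forall>v D. downset D \<longrightarrow> (L v \<subseteq> D \<longleftrightarrow> v \<le> Sup D))"

text \<open>Sets are carriers \<open>A :: 'a set\<close>, possibly empty. A relation from \<open>A\<close> to \<open>B\<close> is a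
  function \<open>'a \<Rightarrow> 'b \<Rightarrow> 'v\<close> of which only the values on \<open>A \<times> B\<close> matter; inequalities and
  equations between relations are therefore always restricted to the carriers, and
  composition names the carrier in the middle.\<close>

definition rel_le ::
  "'a set \<Rightarrow> 'b set \<Rightarrow> ('a \<Rightarrow> 'b \<Rightarrow> 'v::quantale) \<Rightarrow> ('a \<Rightarrow> 'b \<Rightarrow> 'v) \<Rightarrow> bool" where
  "rel_le A B J K \<longleftrightarrow> (\<forall>x\<in>A. \<forall>y\<in>B. J x y \<le> K x y)"

definition rel_eq ::
  "'a set \<Rightarrow> 'b set \<Rightarrow> ('a \<Rightarrow> 'b \<Rightarrow> 'v::quantale) \<Rightarrow> ('a \<Rightarrow> 'b \<Rightarrow> 'v) \<Rightarrow> bool" where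
  "rel_eq A B J K \<longleftrightarrow> (\<forall>x\<in>A. \<forall>y\<in>B. J x y = K x y)"

definition rel_comp ::
  "'b set \<Rightarrow> ('a \<Rightarrow> 'b \<Rightarrow> 'v::quantale) \<Rightarrow> ('b \<Rightarrow> 'c \<Rightarrow> 'v) \<Rightarrow> 'a \<Rightarrow> 'c \<Rightarrow> 'v" where
  "rel_comp B J H x z = (SUP y\<in>B. J x y * H y z)"

definition ultrafilters :: "'a set \<Rightarrow> 'a set set set" where
  "ultrafilters A = {\<xx>. \<xx> \<subseteq> Pow A \<and> A \<in> \<xx> \<and> {} \<notin> \<xx> \<and>
     (\<forall>S\<in>\<xx>. \<forall>T\<in>\<xx>. S \<inter> T \<in> \<xx>) \<and>
     (\<forall>S\<in>\<xx>. \<forall>T. S \<subseteq> T \<and> T \<subseteq> A \<longrightarrow> T \<in> \<xx>) \<and>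
     (\<forall>S. S \<subseteq> A \<longrightarrow> S \<in> \<xx> \<or> A - S \<in> \<xx>)}"

definition principal_uf :: "'a set \<Rightarrow> 'a \<Rightarrow> 'a set set" where
  "principal_uf A x = {S. S \<subseteq> A \<and> x \<in> S}"

definition sharp :: "'a set \<Rightarrow> 'a set \<Rightarrow> 'a set set set" where
  "sharp A S = {\<xx> \<in> ultrafilters A. S \<in> \<xx>}"

definition uf_mult :: "'a set \<Rightarrow> 'a set set set set \<Rightarrow> 'a set set" where
  "uf_mult A \<XX> = {S. S \<subseteq> A \<and> sharp A S \<in> \<XX>}"

definition P_ext :: "('a \<Rightarrow> 'b \<Rightarrow> 'v::quantale) \<Rightarrow> 'a set \<Rightarrow> 'b set \<Rightarrow> 'v" where
  "P_ext J S T = (INF t\<in>T. SUP s\<in>S. J s t)"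

definition U_ext :: "('a \<Rightarrow> 'b \<Rightarrow> 'v::quantale) \<Rightarrow> 'a set set \<Rightarrow> 'b set set \<Rightarrow> 'v" where
  "U_ext J \<xx> \<yy> = (INF (S, T)\<in>\<xx> \<times> \<yy>. SUP (s, t)\<in>S \<times> T. J s t)"

definition UV_graph :: "'a set \<Rightarrow> ('a set set \<Rightarrow> 'a \<Rightarrow> 'v::quantale) \<Rightarrow> bool" where
  "UV_graph A \<alpha> \<longleftrightarrow> (\<forall>x\<in>A. 1 \<le> \<alpha> (principal_uf A x) x)"

definition unitary :: "'a set \<Rightarrow> ('a set set \<Rightarrow> 'a \<Rightarrow> 'v::quantale) \<Rightarrow> bool" where
  "unitary A \<alpha> \<longleftrightarrow> UV_graph A \<alpha> \<and>
     (\<forall>\<XX>\<in>ultrafilters (ultrafilters A). \<forall>x\<in>A.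
        U_ext \<alpha> \<XX> (principal_uf A x) \<le> \<alpha> (uf_mult A \<XX>) x)"

definition UV_category :: "'a set \<Rightarrow> ('a set set \<Rightarrow> 'a \<Rightarrow> 'v::quantale) \<Rightarrow> bool" where
  "UV_category A \<alpha> \<longleftrightarrow> UV_graph A \<alpha> \<and>
     (\<forall>\<XX>\<in>ultrafilters (ultrafilters A). \<forall>x\<in>A.
        rel_comp (ultrafilters A) (U_ext \<alpha>) \<alpha> \<XX> x \<le> \<alpha> (uf_mult A \<XX>) x)"

definition preclosure_space :: "'a set \<Rightarrow> ('a set \<Rightarrow> 'a \<Rightarrow> 'v::quantale) \<Rightarrow> bool" where
  "preclosure_space A \<delta> \<longleftrightarrow> (\<forall>x\<in>A. 1 \<le> \<delta> {x} x) \<and>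
     (\<forall>S T. S \<subseteq> T \<and> T \<subseteq> A \<longrightarrow> (\<forall>x\<in>A. \<delta> S x \<le> \<delta> T x))"

definition induced_preclosure ::
  "'a set \<Rightarrow> ('a set set \<Rightarrow> 'a \<Rightarrow> 'v::quantale) \<Rightarrow> 'a set \<Rightarrow> 'a \<Rightarrow> 'v" where
  "induced_preclosure A \<alpha> S x = (SUP \<xx>\<in>{\<xx> \<in> ultrafilters A. S \<in> \<xx>}. \<alpha> \<xx> x)"

definition U_open ::
  "'a set \<Rightarrow> ('a set set \<Rightarrow> 'a \<Rightarrow> 'v::quantale) \<Rightarrow> 'b set \<Rightarrow> ('b set set \<Rightarrow> 'b \<Rightarrow> 'v) \<Rightarrow>
   ('a \<Rightarrow> 'b \<Rightarrow> 'v) \<Rightarrow> bool" where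
  "U_open A \<alpha> B \<beta> J \<longleftrightarrow>
     rel_le (ultrafilters A) B (rel_comp A \<alpha> J) (rel_comp (ultrafilters B) (U_ext J) \<beta>)"

definition U_closed ::
  "'a set \<Rightarrow> ('a set set \<Rightarrow> 'a \<Rightarrow> 'v::quantale) \<Rightarrow> 'b set \<Rightarrow> ('b set set \<Rightarrow> 'b \<Rightarrow> 'v) \<Rightarrow>
   ('a \<Rightarrow> 'b \<Rightarrow> 'v) \<Rightarrow> bool" where
  "U_closed A \<alpha> B \<beta> J \<longleftrightarrow>
     rel_le (ultrafilters A) B (rel_comp (ultrafilters B) (U_ext J) \<beta>) (rel_comp A \<alpha> J)"

definition P_open ::
  "'a set \<Rightarrow> ('a set \<Rightarrow> 'a \<Rightarrow> 'v::quantale) \<Rightarrow> 'b set \<Rightarrow> ('b set \<Rightarrow> 'b \<Rightarrow> 'v) \<Rightarrow>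
   ('a \<Rightarrow> 'b \<Rightarrow> 'v) \<Rightarrow> bool" where
  "P_open A \<delta> B \<zeta> J \<longleftrightarrow>
     rel_le (Pow A) B (rel_comp A \<delta> J) (rel_comp (Pow B) (P_ext J) \<zeta>)"

definition P_closed ::
  "'a set \<Rightarrow> ('a set \<Rightarrow> 'a \<Rightarrow> 'v::quantale) \<Rightarrow> 'b set \<Rightarrow> ('b set \<Rightarrow> 'b \<Rightarrow> 'v) \<Rightarrow>
   ('a \<Rightarrow> 'b \<Rightarrow> 'v) \<Rightarrow> bool" where
  "P_closed A \<delta> B \<zeta> J \<longleftrightarrow>
     rel_le (Pow A) B (rel_comp (Pow B) (P_ext J) \<zeta>) (rel_comp A \<delta> J)"

definition U_compact ::
  "'a set \<Rightarrow> ('a set set \<Rightarrow> 'a \<Rightarrow> 'v::quantale) \<Rightarrow> 'b set \<Rightarrow> ('a \<Rightarrow> 'b \<Rightarrow> 'v) \<Rightarrow> bool" where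
  "U_compact A \<alpha> B J \<longleftrightarrow>
     (\<forall>\<xx>\<in>ultrafilters A. \<forall>y\<in>B.
        U_ext J \<xx> (principal_uf B y) \<le> rel_comp A \<alpha> J \<xx> y)"

end

theory Submission imports Defs
begin

text \<open>
  Write \<open>u \<lless> v\<close> if every family whose supremum dominates \<open>v\<close> has a member above \<open>u\<close>.
  Complete distributivity says that every \<open>v\<close> is the supremum of the \<open>u \<lless> v\<close>, so an inequality
  \<open>v * b \<le> w\<close> may be tested on such \<open>u\<close>. For fixed \<open>u \<lless> v\<close> a bound \<open>v \<le> sup f\<close> provides an
  actual point \<open>i\<close> with \<open>u \<le> f(i)\<close>, so that one can argue with the ordinary relation
  \<open>u \<le> J(s,t)\<close> and with ultrafilters in the classical way.

  The whole theorem rests on the description of both sides of \<open>P\<close>-openness and \<open>P\<close>-closedness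
  as suprema over the ultrafilters that contain a given set:
  \<open>(\<delta> \<odot> J)(S,y) = sup {(\<alpha> \<odot> J)(\<xx>,y) | S \<in> \<xx>}\<close> and
  \<open>(PJ \<odot> \<zeta>)(S,y) = sup {(UJ \<odot> \<beta>)(\<xx>,y) | S \<in> \<xx>}\<close>
  (\<open>rel_comp_induced_preclosure\<close>, \<open>rel_comp_P_ext\<close>). The first is only the distributivity of
  \<open>\<otimes>\<close> over suprema; the second uses the ultrafilter theorem and \<open>\<lless>\<close>. Hence
  the \<open>P\<close>-conditions are the \<open>U\<close>-conditions averaged, that is joined, over all \<open>\<xx> \<ni> S\<close>, which gives the two
  forward implications; compactness is the case of the principal ultrafilter, where
  \<open>k \<le> \<beta>(\<iota> y, y)\<close> applies.

  For the converses one has to recover an inequality at a single \<open>\<xx>\<close> from its averaged form at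
  all \<open>S \<in> \<xx>\<close>. If \<open>H\<close> is below \<open>K\<close> in the averaged sense and \<open>u \<lless> H(\<xx>,y)\<close>, then every
  \<open>S \<in> \<xx>\<close> belongs to some \<open>\<xx>'\<close> with \<open>u \<le> K(\<xx>',y)\<close>. These \<open>\<xx>'\<close> carry an ultrafilter \<open>\<XX>\<close>
  of ultrafilters with \<open>\<mu> \<XX> = \<xx>\<close> and \<open>u \<le> (UK)(\<XX>, \<iota> y)\<close> (\<open>totally_below_U_ext_of_averaged\<close>).
  So it remains to bound \<open>(UK)(\<XX>, \<iota> y)\<close> by \<open>K(\<mu> \<XX>, y)\<close>. For \<open>K = UJ \<odot> \<beta>\<close> that is
  functoriality of \<open>U\<close> on this composite, followed by naturality of \<open>\<mu>\<close> with respect to \<open>J\<close>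
  and unitarity of \<open>\<beta>\<close>; for \<open>K = \<alpha> \<odot> J\<close> it is functoriality, followed by compactness of \<open>J\<close>
  and the associativity law of \<open>\<alpha>\<close>.
\<close>

section \<open>Quantales and the totally below relation\<close>

lemma quantale_mult_left_mono:
  fixes x y z :: "'v::quantale"
  assumes "y \<le> z"
  shows "x * y \<le> x * z"
proof -
  have "z = Sup {y, z}" using assms by (simp add: sup.absorb2)
  then have "x * z = (SUP w\<in>{y, z}. x * w)" by (metis times_Sup)
  then show ?thesis by (metis SUP_upper insertI1)
qed

lemma quantale_mult_right_mono:
  fixes x y z :: "'v::quantale"
  assumes "y \<le> z"
  shows "y * x \<le> z * x"
proof -
  have "z = Sup {y, z}" using assms by (simp add: sup.absorb2)
  then have "z * x = (SUP w\<in>{y, z}. w * x)" by (metis Sup_times)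
  then show ?thesis by (metis SUP_upper insertI1)
qed

lemma quantale_mult_mono:
  fixes w x y z :: "'v::quantale"
  assumes "w \<le> x" "y \<le> z"
  shows "w * y \<le> x * z"
  using assms quantale_mult_left_mono quantale_mult_right_mono order_trans by metis

lemma SUP_mult:
  fixes f :: "'i \<Rightarrow> 'v::quantale"
  shows "(SUP i\<in>I. f i) * b = (SUP i\<in>I. f i * b)"
  by (simp add: Sup_times image_image)

lemma mult_SUP:
  fixes f :: "'i \<Rightarrow> 'v::quantale"
  shows "b * (SUP i\<in>I. f i) = (SUP i\<in>I. b * f i)"
  by (simp add: times_Sup image_image)

definition totally_below :: "'v::complete_lattice \<Rightarrow> 'v \<Rightarrow> bool" (infix "\<lless>" 50) where
  "u \<lless> v \<longleftrightarrow> (\<forall>S. v \<le> Sup S \<longrightarrow> (\<exists>s\<in>S. u \<le> s))"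

lemma totally_below_le_SUP:
  assumes "u \<lless> v" "v \<le> (SUP i\<in>I. f i)"
  obtains i where "i \<in> I" "u \<le> f i"
  using assms unfolding totally_below_def by fastforce

text \<open>The left adjoint of \<open>sup\<close> sends \<open>v\<close> to a set of elements totally below \<open>v\<close>, because the
  downset generated by a family has the same supremum as the family; and the unit of the
  adjunction says that this set already has supremum at least \<open>v\<close>.\<close>

lemma le_Sup_totally_below:
  fixes v :: "'v::completely_distributive_quantale"
  shows "v \<le> Sup {u. u \<lless> v}"
proof -
  obtain L :: "'v \<Rightarrow> 'v set" where down: "\<And>v. downset (L v)"
    and adj: "\<And>v D. downset D \<Longrightarrow> L v \<subseteq> D \<longleftrightarrow> v \<le> Sup D"
    using Sup_left_adjoint by blast
  have "L v \<subseteq> {u. u \<lless> v}"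
  proof
    fix u assume u: "u \<in> L v"
    have "\<exists>s\<in>S. u \<le> s" if "v \<le> Sup S" for S
    proof -
      let ?D = "{w. \<exists>s\<in>S. w \<le> s}"
      have "downset ?D" unfolding downset_def using order_trans by blast
      moreover have "Sup S \<le> Sup ?D" by (rule Sup_subset_mono) blast
      ultimately have "L v \<subseteq> ?D" using that adj order_trans by blast
      then show ?thesis using u by blast
    qed
    then show "u \<in> {u. u \<lless> v}" unfolding totally_below_def by blast
  qed
  then have "Sup (L v) \<le> Sup {u. u \<lless> v}" by (rule Sup_subset_mono)
  moreover have "v \<le> Sup (L v)" using adj down by blast
  ultimately show ?thesis by (rule order_trans[rotated])
qed

lemma le_if_totally_below_le:
  fixes v :: "'v::completely_distributive_quantale"
  assumes "\<And>u. u \<lless> v \<Longrightarrow> u \<le> w"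
  shows "v \<le> w"
proof -
  have "Sup {u. u \<lless> v} \<le> w" by (rule Sup_least) (simp add: assms)
  then show ?thesis using le_Sup_totally_below order_trans by blast
qed

lemma mult_le_if_totally_below_mult_le:
  fixes v :: "'v::completely_distributive_quantale"
  assumes "\<And>u. u \<lless> v \<Longrightarrow> u * b \<le> w"
  shows "v * b \<le> w"
proof -
  have "v * b \<le> Sup {u. u \<lless> v} * b"
    by (rule quantale_mult_right_mono) (rule le_Sup_totally_below)
  also have "\<dots> = (SUP u\<in>{u. u \<lless> v}. u * b)" by (rule Sup_times)
  also have "\<dots> \<le> w" by (rule SUP_least) (simp add: assms)
  finally show ?thesis .
qed

section \<open>Ultrafilters on a set\<close>

lemma ultrafilterD:
  assumes "\<xx> \<in> ultrafilters A"
  shows ultrafilter_subset: "S \<in> \<xx> \<Longrightarrow> S \<subseteq> A"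
    and ultrafilter_carrier: "A \<in> \<xx>"
    and ultrafilter_nonempty: "S \<in> \<xx> \<Longrightarrow> S \<noteq> {}"
    and ultrafilter_Int: "S \<in> \<xx> \<Longrightarrow> T \<in> \<xx> \<Longrightarrow> S \<inter> T \<in> \<xx>"
    and ultrafilter_superset: "S \<in> \<xx> \<Longrightarrow> S \<subseteq> T \<Longrightarrow> T \<subseteq> A \<Longrightarrow> T \<in> \<xx>"
    and ultrafilter_Diff: "S \<subseteq> A \<Longrightarrow> S \<notin> \<xx> \<Longrightarrow> A - S \<in> \<xx>"
proof -
  have *: "\<xx> \<subseteq> Pow A" "A \<in> \<xx>" "{} \<notin> \<xx>" "\<forall>S\<in>\<xx>. \<forall>T\<in>\<xx>. S \<inter> T \<in> \<xx>"
    "\<forall>S\<in>\<xx>. \<forall>T. S \<subseteq> T \<and> T \<subseteq> A \<longrightarrow> T \<in> \<xx>" "\<forall>S. S \<subseteq> A \<longrightarrow> S \<in> \<xx> \<or> A - S \<in> \<xx>"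
    using assms unfolding ultrafilters_def mem_Collect_eq by - (elim conjE, assumption)+
  show "S \<in> \<xx> \<Longrightarrow> S \<subseteq> A" using *(1) by blast
  show "A \<in> \<xx>" by (rule *(2))
  show "S \<in> \<xx> \<Longrightarrow> S \<noteq> {}" using *(3) by blast
  show "S \<in> \<xx> \<Longrightarrow> T \<in> \<xx> \<Longrightarrow> S \<inter> T \<in> \<xx>" using *(4) by blast
  show "S \<in> \<xx> \<Longrightarrow> S \<subseteq> T \<Longrightarrow> T \<subseteq> A \<Longrightarrow> T \<in> \<xx>" using *(5) by blast
  show "S \<subseteq> A \<Longrightarrow> S \<notin> \<xx> \<Longrightarrow> A - S \<in> \<xx>" using *(6) by blast
qed

lemma ultrafiltersI:
  assumes "\<And>S. S \<in> \<xx> \<Longrightarrow> S \<subseteq> A" "A \<in> \<xx>" "{} \<notin> \<xx>"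
    and "\<And>S T. S \<in> \<xx> \<Longrightarrow> T \<in> \<xx> \<Longrightarrow> S \<inter> T \<in> \<xx>"
    and "\<And>S T. S \<in> \<xx> \<Longrightarrow> S \<subseteq> T \<Longrightarrow> T \<subseteq> A \<Longrightarrow> T \<in> \<xx>"
    and "\<And>S. S \<subseteq> A \<Longrightarrow> S \<in> \<xx> \<or> A - S \<in> \<xx>"
  shows "\<xx> \<in> ultrafilters A"
  unfolding ultrafilters_def mem_Collect_eq
proof (intro conjI ballI allI impI)
  show "\<xx> \<subseteq> Pow A" using assms(1) by (rule PowI[THEN subsetI])
qed (use assms in \<open>(elim conjE)?, simp_all\<close>)

lemma ultrafilter_memI:
  assumes \<xx>: "\<xx> \<in> ultrafilters A" and "T \<subseteq> A" and "\<And>S. S \<in> \<xx> \<Longrightarrow> S \<inter> T \<noteq> {}"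
  shows "T \<in> \<xx>"
  using assms(2,3) ultrafilter_Diff[OF \<xx>, of T] by blast

lemma ultrafilter_eqI:
  assumes \<xx>: "\<xx> \<in> ultrafilters A" and \<yy>: "\<yy> \<in> ultrafilters A" and sub: "\<xx> \<subseteq> \<yy>"
  shows "\<xx> = \<yy>"
proof
  show "\<yy> \<subseteq> \<xx>"
  proof
    fix T assume T: "T \<in> \<yy>"
    show "T \<in> \<xx>"
    proof (rule ultrafilter_memI[OF \<xx>])
      show "T \<subseteq> A" using ultrafilter_subset[OF \<yy> T] .
      show "S \<inter> T \<noteq> {}" if "S \<in> \<xx>" for S
        using that sub T ultrafilter_Int[OF \<yy>] ultrafilter_nonempty[OF \<yy>] by blast
    qed
  qed
qed (rule sub)

lemma principal_uf_in_ultrafilters: "x \<in> A \<Longrightarrow> principal_uf A x \<in> ultrafilters A"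
  unfolding ultrafilters_def principal_uf_def by blast

text \<open>Zorn's lemma is applied to the families with the properties \<open>P\<close> below. In a maximal such
  family \<open>G\<close> any set that meets all members of \<open>G\<close> can be adjoined and so already belongs to \<open>G\<close>;
  both the closure under supersets and the ultrafilter dichotomy follow from this.\<close>

lemma ultrafilter_extending_filter_base:
  assumes sub: "\<B> \<subseteq> Pow A" and ne: "\<B> \<noteq> {}" and nonempty: "{} \<notin> \<B>"
    and directed: "\<And>S T. S \<in> \<B> \<Longrightarrow> T \<in> \<B> \<Longrightarrow> \<exists>R\<in>\<B>. R \<subseteq> S \<inter> T"
  obtains \<xx> where "\<xx> \<in> ultrafilters A" "\<B> \<subseteq> \<xx>"
proof -
  define F where "F = {S. S \<subseteq> A \<and> (\<exists>R\<in>\<B>. R \<subseteq> S)}"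
  define P where "P = (\<lambda>G. F \<subseteq> G \<and> G \<subseteq> Pow A \<and> {} \<notin> G \<and> (\<forall>S\<in>G. \<forall>T\<in>G. S \<inter> T \<in> G))"
  have PI: "P G" if "F \<subseteq> G" "G \<subseteq> Pow A" "{} \<notin> G" "\<And>S T. S \<in> G \<Longrightarrow> T \<in> G \<Longrightarrow> S \<inter> T \<in> G"
    for G using that unfolding P_def by simp
  have PD: "F \<subseteq> G" "G \<subseteq> Pow A" "{} \<notin> G" "S \<in> G \<Longrightarrow> T \<in> G \<Longrightarrow> S \<inter> T \<in> G"
    if "P G" for G S T using that unfolding P_def by simp_all
  have F_Int: "S \<inter> T \<in> F" if ST: "S \<in> F" "T \<in> F" for S T
  proof -
    obtain S' T' where *: "S' \<in> \<B>" "S' \<subseteq> S" "T' \<in> \<B>" "T' \<subseteq> T" "S \<subseteq> A"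
      using ST unfolding F_def by blast
    obtain R where R: "R \<in> \<B>" "R \<subseteq> S' \<inter> T'" using directed[OF *(1,3)] by blast
    have "R \<subseteq> S \<inter> T" using R(2) *(2,4) by blast
    moreover have "S \<inter> T \<subseteq> A" using *(5) by blast
    ultimately show ?thesis unfolding F_def mem_Collect_eq using R(1) by (intro conjI bexI)
  qed
  have "{} \<notin> F" using nonempty unfolding F_def by auto
  then have "P F" by (intro PI F_Int) (auto simp: F_def)
  have "\<exists>U\<in>Collect P. \<forall>X\<in>C. X \<subseteq> U" if C: "subset.chain (Collect P) C" for C
  proof (cases "C = {}")
    case True
    then show ?thesis using \<open>P F\<close> by blast
  next
    case False
    have mem: "P X" if "X \<in> C" for X
      using C that unfolding subset.chain_def by blast
    have lin: "X \<subseteq> Y \<or> Y \<subseteq> X" if "X \<in> C" "Y \<in> C" for X Y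
      using C that unfolding subset.chain_def by blast
    have "P (\<Union>C)"
    proof (rule PI)
      show "F \<subseteq> \<Union>C" using False PD(1)[OF mem] by blast
      show "\<Union>C \<subseteq> Pow A" using PD(2)[OF mem] by blast
      show "{} \<notin> \<Union>C" using PD(3)[OF mem] by blast
      fix S T assume "S \<in> \<Union>C" "T \<in> \<Union>C"
      then obtain X Y where "X \<in> C" "S \<in> X" "Y \<in> C" "T \<in> Y" by blast
      then obtain Z where "Z \<in> C" "S \<in> Z" "T \<in> Z" using lin[of X Y] by blast
      then show "S \<inter> T \<in> \<Union>C" using PD(4)[OF mem] by blast
    qed
    then show ?thesis by blast
  qed
  then obtain G where G: "P G" and maximal: "\<And>X. P X \<Longrightarrow> G \<subseteq> X \<Longrightarrow> X = G"
    using subset_Zorn[of "Collect P"] by auto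
  note FG = PD(1)[OF G] and GA = PD(2)[OF G] and Gne = PD(3)[OF G] and GInt = PD(4)[OF G]
  have "A \<in> F" using ne sub unfolding F_def by blast
  then have AG: "A \<in> G" using FG by blast
  have adjoin: "T \<in> G" if "T \<subseteq> A" and meets: "\<And>R. R \<in> G \<Longrightarrow> T \<inter> R \<noteq> {}" for T
  proof -
    let ?G = "G \<union> (\<inter>) T ` G"
    have "P ?G"
    proof (rule PI)
      show "F \<subseteq> ?G" using FG by (rule le_supI1)
      show "?G \<subseteq> Pow A" using GA that(1) by auto
      show "{} \<notin> ?G" using Gne meets by fastforce
      fix S S' assume S: "S \<in> ?G" and S': "S' \<in> ?G"
      obtain R where R: "R \<in> G" "S = R \<or> S = T \<inter> R" using S by blast
      obtain R' where R': "R' \<in> G" "S' = R' \<or> S' = T \<inter> R'" using S' by blast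
      have "S \<inter> S' = R \<inter> R' \<or> S \<inter> S' = T \<inter> (R \<inter> R')" using R(2) R'(2) by auto
      then show "S \<inter> S' \<in> ?G" using GInt[OF R(1) R'(1)] by (metis UnCI imageI)
    qed
    then have "?G = G" by (rule maximal) simp
    moreover have "T \<inter> A = T" using \<open>T \<subseteq> A\<close> by blast
    then have "T \<in> ?G" using AG by (metis UnI2 imageI)
    ultimately show ?thesis by simp
  qed
  have upward: "T \<in> G" if "S \<in> G" "S \<subseteq> T" "T \<subseteq> A" for S T
  proof (rule adjoin[OF that(3)])
    fix R assume "R \<in> G"
    then have "S \<inter> R \<noteq> {}" using GInt[OF that(1)] Gne by fastforce
    then show "T \<inter> R \<noteq> {}" using that(2) by blast
  qed
  have dichotomy: "S \<in> G \<or> A - S \<in> G" if "S \<subseteq> A" for S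
  proof (rule disjCI)
    assume "A - S \<notin> G"
    show "S \<in> G"
    proof (rule adjoin[OF that])
      show "S \<inter> R \<noteq> {}" if "R \<in> G" for R
      proof
        assume "S \<inter> R = {}"
        then have "R \<subseteq> A - S" using GA that by blast
        then show False using upward[OF that] \<open>A - S \<notin> G\<close> by blast
      qed
    qed
  qed
  have "S \<subseteq> A" if "S \<in> G" for S using GA that by blast
  then have "G \<in> ultrafilters A"
    using AG Gne GInt upward dichotomy by (rule ultrafiltersI)
  moreover have "\<B> \<subseteq> F" using sub unfolding F_def by blast
  ultimately show ?thesis using FG that by blast
qed

lemma sharp_carrier: "sharp A A = ultrafilters A"
  unfolding sharp_def using ultrafilter_carrier by blast

lemma sharp_mono:
  assumes "S \<subseteq> T" "T \<subseteq> A"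
  shows "sharp A S \<subseteq> sharp A T"
  unfolding sharp_def using assms ultrafilter_superset by blast

lemma sharp_Int:
  assumes "S \<subseteq> A" "T \<subseteq> A"
  shows "sharp A (S \<inter> T) = sharp A S \<inter> sharp A T"
proof
  show "sharp A (S \<inter> T) \<subseteq> sharp A S \<inter> sharp A T"
    using sharp_mono[of "S \<inter> T"] assms by blast
  show "sharp A S \<inter> sharp A T \<subseteq> sharp A (S \<inter> T)"
    unfolding sharp_def using ultrafilter_Int by blast
qed

lemma sharp_Diff:
  assumes "S \<subseteq> A"
  shows "ultrafilters A - sharp A S \<subseteq> sharp A (A - S)"
  unfolding sharp_def using assms ultrafilter_Diff by blast

lemma uf_mult_in_ultrafilters:
  assumes \<XX>: "\<XX> \<in> ultrafilters (ultrafilters A)"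
  shows "uf_mult A \<XX> \<in> ultrafilters A"
proof -
  have sub: "sharp A S \<subseteq> ultrafilters A" for S unfolding sharp_def by blast
  have iff: "S \<in> uf_mult A \<XX> \<longleftrightarrow> S \<subseteq> A \<and> sharp A S \<in> \<XX>" for S
    unfolding uf_mult_def by simp
  show ?thesis
  proof (rule ultrafiltersI)
    show "S \<subseteq> A" if "S \<in> uf_mult A \<XX>" for S using that unfolding iff by (rule conjunct1)
    show "A \<in> uf_mult A \<XX>"
      unfolding iff using ultrafilter_carrier[OF \<XX>] by (simp add: sharp_carrier)
    have "sharp A {} = {}" unfolding sharp_def using ultrafilter_nonempty by blast
    then show "{} \<notin> uf_mult A \<XX>" unfolding iff using ultrafilter_nonempty[OF \<XX>] by metis
    show "S \<inter> T \<in> uf_mult A \<XX>" if "S \<in> uf_mult A \<XX>" "T \<in> uf_mult A \<XX>" for S T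
      using that ultrafilter_Int[OF \<XX>, of "sharp A S" "sharp A T"]
      by (auto simp: iff sharp_Int)
    show "T \<in> uf_mult A \<XX>" if "S \<in> uf_mult A \<XX>" "S \<subseteq> T" "T \<subseteq> A" for S T
      using that ultrafilter_superset[OF \<XX> _ sharp_mono[OF that(2,3)] sub] by (simp add: iff)
    show "S \<in> uf_mult A \<XX> \<or> A - S \<in> uf_mult A \<XX>" if "S \<subseteq> A" for S
      using that ultrafilter_Diff[OF \<XX> sub, of S]
        ultrafilter_superset[OF \<XX> _ sharp_Diff[OF that] sub]
      by (auto simp: iff)
  qed
qed

section \<open>The extended relations and composition\<close>

lemma U_ext_le:
  assumes "S \<in> \<xx>" "T \<in> \<yy>"
  shows "U_ext J \<xx> \<yy> \<le> (SUP (s, t)\<in>S \<times> T. J s t)"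
  unfolding U_ext_def using assms by (intro INF_lower2[of "(S, T)"]) auto

lemma le_U_ext:
  assumes "\<And>S T. S \<in> \<xx> \<Longrightarrow> T \<in> \<yy> \<Longrightarrow> \<exists>s\<in>S. \<exists>t\<in>T. u \<le> J s t"
  shows "u \<le> U_ext J \<xx> \<yy>"
  unfolding U_ext_def
proof (rule INF_greatest, clarify)
  fix S T assume "S \<in> \<xx>" "T \<in> \<yy>"
  then obtain s t where "s \<in> S" "t \<in> T" "u \<le> J s t" using assms by blast
  then show "u \<le> (SUP (s, t)\<in>S \<times> T. J s t)"
    by (intro SUP_upper2[of "(s, t)"]) auto
qed

lemma rel_comp_upper: "y \<in> B \<Longrightarrow> J x y * H y z \<le> rel_comp B J H x z"
  unfolding rel_comp_def by (rule SUP_upper)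

text \<open>The multiplication \<open>\<mu>\<close> is lax natural with respect to \<open>\<V>\<close>-relations: an upper bound
  of \<open>J\<close> over \<open>S \<times> T\<close> also bounds \<open>UJ\<close> over \<open>S\<^sup>\<sharp> \<times> T\<^sup>\<sharp>\<close>.\<close>

lemma U_ext_U_ext_le_uf_mult:
  "U_ext (U_ext J) \<XX> \<YY> \<le> U_ext J (uf_mult A \<XX>) (uf_mult B \<YY>)"
  unfolding U_ext_def[of J "uf_mult A \<XX>"]
proof (rule INF_greatest, clarify)
  fix S T assume "S \<in> uf_mult A \<XX>" "T \<in> uf_mult B \<YY>"
  then have "sharp A S \<in> \<XX>" "sharp B T \<in> \<YY>" unfolding uf_mult_def by auto
  then have "U_ext (U_ext J) \<XX> \<YY> \<le> (SUP (\<xx>, \<yy>)\<in>sharp A S \<times> sharp B T. U_ext J \<xx> \<yy>)"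
    by (rule U_ext_le)
  also have "\<dots> \<le> (SUP (s, t)\<in>S \<times> T. J s t)"
    by (rule SUP_least, clarify, rule U_ext_le) (auto simp: sharp_def)
  finally show "U_ext (U_ext J) \<XX> \<YY> \<le> (SUP (s, t)\<in>S \<times> T. J s t)" .
qed

section \<open>Averaging over the ultrafilters that contain a set\<close>

lemma induced_preclosure_alt:
  "induced_preclosure A \<alpha> S x = (SUP \<xx>\<in>sharp A S. \<alpha> \<xx> x)"
  unfolding induced_preclosure_def sharp_def ..

lemma preclosure_space_induced_preclosure:
  assumes "UV_graph A \<alpha>"
  shows "preclosure_space A (induced_preclosure A \<alpha>)"
  unfolding preclosure_space_def induced_preclosure_alt
proof (intro conjI ballI allI impI)
  fix x assume x: "x \<in> A"
  then have "principal_uf A x \<in> sharp A {x}"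
    using principal_uf_in_ultrafilters unfolding sharp_def principal_uf_def by fastforce
  moreover have "1 \<le> \<alpha> (principal_uf A x) x" using assms x unfolding UV_graph_def by blast
  ultimately show "1 \<le> (SUP \<xx>\<in>sharp A {x}. \<alpha> \<xx> x)" by (rule SUP_upper2)
next
  fix S T x assume "S \<subseteq> T \<and> T \<subseteq> A"
  then show "(SUP \<xx>\<in>sharp A S. \<alpha> \<xx> x) \<le> (SUP \<xx>\<in>sharp A T. \<alpha> \<xx> x)"
    by (intro SUP_subset_mono sharp_mono) auto
qed

lemma rel_comp_induced_preclosure:
  "rel_comp A (induced_preclosure A \<alpha>) J S y = (SUP \<xx>\<in>sharp A S. rel_comp A \<alpha> J \<xx> y)"
  unfolding rel_comp_def induced_preclosure_alt SUP_mult by (rule SUP_commute)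

text \<open>Each \<open>T \<in> \<yy>\<close> satisfies \<open>(UJ)(\<xx>,\<yy>) \<le> sup {J(s,t) | s \<in> S, t \<in> T}\<close>, hence contains a
  point of the set below; and an ultrafilter contains every set that meets all its members.\<close>

lemma related_set_mem_ultrafilter:
  assumes u: "u \<lless> U_ext J \<xx> \<yy>" and S: "S \<in> \<xx>" and \<yy>: "\<yy> \<in> ultrafilters B"
  shows "{t \<in> B. \<exists>s\<in>S. u \<le> J s t} \<in> \<yy>"
proof (rule ultrafilter_memI[OF \<yy>])
  fix T assume T: "T \<in> \<yy>"
  obtain p where p: "p \<in> S \<times> T" "u \<le> (case p of (s, t) \<Rightarrow> J s t)"
    using totally_below_le_SUP[OF u U_ext_le[OF S T, of J]] .
  obtain s t where "s \<in> S" "t \<in> T" "u \<le> J s t" using p by (cases p) auto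
  then show "T \<inter> {t \<in> B. \<exists>s\<in>S. u \<le> J s t} \<noteq> {}"
    using ultrafilter_subset[OF \<yy> T] by blast
qed blast

text \<open>Conversely, if each \<open>t \<in> T\<close> is \<open>u\<close>-related to a point of \<open>S\<close>, then the sets \<open>R T'\<close>
  of those \<open>s \<in> S\<close> that are \<open>u\<close>-related to a point of \<open>T \<inter> T'\<close>, for \<open>T' \<in> \<yy>\<close>, form a filter
  base. An ultrafilter \<open>\<xx>\<close> refining it satisfies \<open>u \<le> (UJ)(\<xx>,\<yy>)\<close>, because each of its members
  meets each \<open>R T'\<close>.\<close>

lemma totally_below_P_ext_ultrafilter:
  assumes u: "u \<lless> P_ext J S T" and S: "S \<subseteq> A" and \<yy>: "\<yy> \<in> ultrafilters B" and T: "T \<in> \<yy>"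
  obtains \<xx> where "\<xx> \<in> sharp A S" "u \<le> U_ext J \<xx> \<yy>"
proof -
  have pt: "\<exists>s\<in>S. u \<le> J s t" if "t \<in> T" for t
  proof -
    have "P_ext J S T \<le> (SUP s\<in>S. J s t)" unfolding P_ext_def using that by (rule INF_lower)
    then show ?thesis using totally_below_le_SUP[OF u] by blast
  qed
  define R where "R T' = {s \<in> S. \<exists>t\<in>T \<inter> T'. u \<le> J s t}" for T'
  obtain \<xx> where \<xx>: "\<xx> \<in> ultrafilters A" and R: "R ` \<yy> \<subseteq> \<xx>"
  proof (rule ultrafilter_extending_filter_base[of "R ` \<yy>" A])
    show "R ` \<yy> \<subseteq> Pow A" unfolding R_def using S by blast
    show "R ` \<yy> \<noteq> {}" using T by blast
    show "{} \<notin> R ` \<yy>"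
    proof
      assume "{} \<in> R ` \<yy>"
      then obtain T' where T': "T' \<in> \<yy>" "R T' = {}" by auto
      obtain t where "t \<in> T \<inter> T'"
        using ultrafilter_nonempty[OF \<yy> ultrafilter_Int[OF \<yy> T T'(1)]] by blast
      then show False using pt[of t] T'(2) unfolding R_def by blast
    qed
    show "\<exists>X\<in>R ` \<yy>. X \<subseteq> X1 \<inter> X2" if X: "X1 \<in> R ` \<yy>" "X2 \<in> R ` \<yy>" for X1 X2
    proof -
      obtain T1 T2 where *: "T1 \<in> \<yy>" "X1 = R T1" "T2 \<in> \<yy>" "X2 = R T2" using X by blast
      then have "R (T1 \<inter> T2) \<subseteq> X1 \<inter> X2" unfolding R_def by blast
      then show ?thesis using ultrafilter_Int[OF \<yy> *(1) *(3)] by blast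
    qed
  qed
  have "S \<in> \<xx>" using R T ultrafilter_superset[OF \<xx> _ _ S] unfolding R_def by blast
  moreover have "u \<le> U_ext J \<xx> \<yy>"
  proof (rule le_U_ext)
    fix S' T' assume "S' \<in> \<xx>" "T' \<in> \<yy>"
    then have "S' \<inter> R T' \<noteq> {}"
      using R ultrafilter_Int[OF \<xx>] ultrafilter_nonempty[OF \<xx>] by blast
    then show "\<exists>s\<in>S'. \<exists>t\<in>T'. u \<le> J s t" unfolding R_def by blast
  qed
  ultimately show ?thesis using that \<xx> unfolding sharp_def by blast
qed

text \<open>The two preceding facts are the two inequalities here: the first supplies a set \<open>T\<close> for a
  given pair \<open>(\<xx>, \<yy>)\<close>, the second supplies \<open>\<xx>\<close> for a given pair \<open>(T, \<yy>)\<close>.\<close>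

lemma rel_comp_P_ext:
  fixes J :: "'a \<Rightarrow> 'b \<Rightarrow> 'v::completely_distributive_quantale"
  assumes S: "S \<subseteq> A"
  shows "rel_comp (Pow B) (P_ext J) (induced_preclosure B \<beta>) S y =
    (SUP \<xx>\<in>sharp A S. rel_comp (ultrafilters B) (U_ext J) \<beta> \<xx> y)"
    (is "?P = ?U")
proof (rule antisym)
  show "?P \<le> ?U"
    unfolding rel_comp_def[of "Pow B"] induced_preclosure_alt mult_SUP
  proof (intro SUP_least)
    fix T \<yy> assume "\<yy> \<in> sharp B T"
    then have \<yy>: "\<yy> \<in> ultrafilters B" and T: "T \<in> \<yy>" unfolding sharp_def by auto
    show "P_ext J S T * \<beta> \<yy> y \<le> ?U"
    proof (rule mult_le_if_totally_below_mult_le)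
      fix u assume "u \<lless> P_ext J S T"
      then obtain \<xx> where \<xx>: "\<xx> \<in> sharp A S" "u \<le> U_ext J \<xx> \<yy>"
        using totally_below_P_ext_ultrafilter S \<yy> T by blast
      have "u * \<beta> \<yy> y \<le> U_ext J \<xx> \<yy> * \<beta> \<yy> y"
        using \<xx>(2) by (rule quantale_mult_right_mono)
      also have "\<dots> \<le> rel_comp (ultrafilters B) (U_ext J) \<beta> \<xx> y"
        using \<yy> by (rule rel_comp_upper)
      also have "\<dots> \<le> ?U" using \<xx>(1) by (rule SUP_upper)
      finally show "u * \<beta> \<yy> y \<le> ?U" .
    qed
  qed
next
  show "?U \<le> ?P"
    unfolding rel_comp_def[of "ultrafilters B"]
  proof (intro SUP_least)
    fix \<xx> \<yy> assume \<xx>: "\<xx> \<in> sharp A S" and \<yy>: "\<yy> \<in> ultrafilters B"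
    show "U_ext J \<xx> \<yy> * \<beta> \<yy> y \<le> ?P"
    proof (rule mult_le_if_totally_below_mult_le)
      fix u assume u: "u \<lless> U_ext J \<xx> \<yy>"
      let ?T = "{t \<in> B. \<exists>s\<in>S. u \<le> J s t}"
      have T: "?T \<in> \<yy>"
        using related_set_mem_ultrafilter[OF u _ \<yy>] \<xx> unfolding sharp_def by blast
      have "u \<le> P_ext J S ?T"
        unfolding P_ext_def by (rule INF_greatest) (auto intro: SUP_upper2)
      moreover have "\<beta> \<yy> y \<le> induced_preclosure B \<beta> ?T y"
        unfolding induced_preclosure_def using T \<yy> by (intro SUP_upper) blast
      ultimately have "u * \<beta> \<yy> y \<le> P_ext J S ?T * induced_preclosure B \<beta> ?T y"
        by (rule quantale_mult_mono)
      also have "\<dots> \<le> ?P" by (rule rel_comp_upper) blast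
      finally show "u * \<beta> \<yy> y \<le> ?P" .
    qed
  qed
qed

corollary P_open_iff_averaged:
  fixes J :: "'a \<Rightarrow> 'b \<Rightarrow> 'v::completely_distributive_quantale"
  shows "P_open A (induced_preclosure A \<alpha>) B (induced_preclosure B \<beta>) J \<longleftrightarrow>
    (\<forall>S\<in>Pow A. \<forall>y\<in>B. (SUP \<xx>\<in>sharp A S. rel_comp A \<alpha> J \<xx> y) \<le>
      (SUP \<xx>\<in>sharp A S. rel_comp (ultrafilters B) (U_ext J) \<beta> \<xx> y))"
  unfolding P_open_def rel_le_def
  by (intro ball_cong refl) (simp add: rel_comp_induced_preclosure rel_comp_P_ext)

corollary P_closed_iff_averaged:
  fixes J :: "'a \<Rightarrow> 'b \<Rightarrow> 'v::completely_distributive_quantale"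
  shows "P_closed A (induced_preclosure A \<alpha>) B (induced_preclosure B \<beta>) J \<longleftrightarrow>
    (\<forall>S\<in>Pow A. \<forall>y\<in>B. (SUP \<xx>\<in>sharp A S. rel_comp (ultrafilters B) (U_ext J) \<beta> \<xx> y) \<le>
      (SUP \<xx>\<in>sharp A S. rel_comp A \<alpha> J \<xx> y))"
  unfolding P_closed_def rel_le_def
  by (intro ball_cong refl) (simp add: rel_comp_induced_preclosure rel_comp_P_ext)

section \<open>From ultrafilters to their averages\<close>

lemma U_open_imp_P_open:
  fixes J :: "'a \<Rightarrow> 'b \<Rightarrow> 'v::completely_distributive_quantale"
  assumes "U_open A \<alpha> B \<beta> J"
  shows "P_open A (induced_preclosure A \<alpha>) B (induced_preclosure B \<beta>) J"
  unfolding P_open_iff_averaged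
proof (intro ballI SUP_mono)
  fix y \<xx> S assume "y \<in> B" "\<xx> \<in> sharp A S"
  then show "\<exists>\<xx>'\<in>sharp A S. rel_comp A \<alpha> J \<xx> y
      \<le> rel_comp (ultrafilters B) (U_ext J) \<beta> \<xx>' y"
    using assms unfolding U_open_def rel_le_def sharp_def by blast
qed

lemma U_closed_imp_P_closed:
  fixes J :: "'a \<Rightarrow> 'b \<Rightarrow> 'v::completely_distributive_quantale"
  assumes "U_closed A \<alpha> B \<beta> J"
  shows "P_closed A (induced_preclosure A \<alpha>) B (induced_preclosure B \<beta>) J"
  unfolding P_closed_iff_averaged
proof (intro ballI SUP_mono)
  fix y \<xx> S assume "y \<in> B" "\<xx> \<in> sharp A S"
  then show "\<exists>\<xx>'\<in>sharp A S. rel_comp (ultrafilters B) (U_ext J) \<beta> \<xx> y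
      \<le> rel_comp A \<alpha> J \<xx>' y"
    using assms unfolding U_closed_def rel_le_def sharp_def by blast
qed

lemma U_closed_imp_U_compact:
  assumes "UV_graph B \<beta>" and closed: "U_closed A \<alpha> B \<beta> J"
  shows "U_compact A \<alpha> B J"
  unfolding U_compact_def
proof (intro ballI)
  fix \<xx> y assume \<xx>: "\<xx> \<in> ultrafilters A" and y: "y \<in> B"
  have "1 \<le> \<beta> (principal_uf B y) y" using assms(1) y unfolding UV_graph_def by blast
  then have "U_ext J \<xx> (principal_uf B y) \<le> U_ext J \<xx> (principal_uf B y) * \<beta> (principal_uf B y) y"
    using quantale_mult_left_mono by fastforce
  also have "\<dots> \<le> rel_comp (ultrafilters B) (U_ext J) \<beta> \<xx> y"
    using y by (intro rel_comp_upper principal_uf_in_ultrafilters)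
  also have "\<dots> \<le> rel_comp A \<alpha> J \<xx> y"
    using closed \<xx> y unfolding U_closed_def rel_le_def by blast
  finally show "U_ext J \<xx> (principal_uf B y) \<le> rel_comp A \<alpha> J \<xx> y" .
qed

section \<open>From averages back to single ultrafilters\<close>

text \<open>The ultrafilters \<open>\<xx>'\<close> with \<open>u \<le> K(\<xx>',y)\<close> form a set \<open>W\<close> that meets \<open>S\<^sup>\<sharp>\<close> for every
  \<open>S \<in> \<xx>\<close>. An ultrafilter \<open>\<XX>\<close> containing all \<open>S\<^sup>\<sharp> \<inter> W\<close> has \<open>\<xx> \<subseteq> \<mu> \<XX>\<close>, and ultrafilters
  that are comparable are equal.\<close>

lemma totally_below_U_ext_of_averaged:
  fixes H K :: "'a set set \<Rightarrow> 'b \<Rightarrow> 'v::completely_distributive_quantale"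
  assumes averaged: "\<And>S. S \<subseteq> A \<Longrightarrow> (SUP \<xx>\<in>sharp A S. H \<xx> y) \<le> (SUP \<xx>\<in>sharp A S. K \<xx> y)"
    and \<xx>: "\<xx> \<in> ultrafilters A" and u: "u \<lless> H \<xx> y"
  obtains \<XX> where "\<XX> \<in> ultrafilters (ultrafilters A)" "uf_mult A \<XX> = \<xx>"
    "u \<le> U_ext K \<XX> (principal_uf B y)"
proof -
  define W where "W = {\<xx>' \<in> ultrafilters A. u \<le> K \<xx>' y}"
  have meets: "sharp A S \<inter> W \<noteq> {}" if "S \<in> \<xx>" for S
  proof -
    have "H \<xx> y \<le> (SUP \<xx>\<in>sharp A S. H \<xx> y)"
      using \<xx> that by (intro SUP_upper) (simp add: sharp_def)
    also have "\<dots> \<le> (SUP \<xx>\<in>sharp A S. K \<xx> y)"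
      using ultrafilter_subset[OF \<xx> that] by (rule averaged)
    finally obtain \<xx>' where "\<xx>' \<in> sharp A S" "u \<le> K \<xx>' y" by (rule totally_below_le_SUP[OF u])
    then show ?thesis unfolding W_def sharp_def by blast
  qed
  obtain \<XX> where \<XX>: "\<XX> \<in> ultrafilters (ultrafilters A)"
    and base: "(\<lambda>S. sharp A S \<inter> W) ` \<xx> \<subseteq> \<XX>"
  proof (rule ultrafilter_extending_filter_base[of "(\<lambda>S. sharp A S \<inter> W) ` \<xx>" "ultrafilters A"])
    show "(\<lambda>S. sharp A S \<inter> W) ` \<xx> \<subseteq> Pow (ultrafilters A)" unfolding W_def by blast
    show "(\<lambda>S. sharp A S \<inter> W) ` \<xx> \<noteq> {}" using ultrafilter_carrier[OF \<xx>] by blast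
    show "{} \<notin> (\<lambda>S. sharp A S \<inter> W) ` \<xx>" using meets by fastforce
    show "\<exists>X\<in>(\<lambda>S. sharp A S \<inter> W) ` \<xx>. X \<subseteq> X1 \<inter> X2"
      if X: "X1 \<in> (\<lambda>S. sharp A S \<inter> W) ` \<xx>" "X2 \<in> (\<lambda>S. sharp A S \<inter> W) ` \<xx>" for X1 X2
    proof -
      obtain S1 S2 where *: "S1 \<in> \<xx>" "X1 = sharp A S1 \<inter> W" "S2 \<in> \<xx>" "X2 = sharp A S2 \<inter> W"
        using X by blast
      have "sharp A (S1 \<inter> S2) \<inter> W \<subseteq> X1 \<inter> X2"
        using sharp_Int ultrafilter_subset[OF \<xx>] * by blast
      then show ?thesis using ultrafilter_Int[OF \<xx> *(1) *(3)] by blast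
    qed
  qed
  have "\<xx> \<subseteq> uf_mult A \<XX>"
  proof
    fix S assume S: "S \<in> \<xx>"
    have "sharp A S \<in> \<XX>"
    proof (rule ultrafilter_superset[OF \<XX>])
      show "sharp A S \<inter> W \<in> \<XX>" using base S by blast
    qed (auto simp: sharp_def)
    then show "S \<in> uf_mult A \<XX>"
      using ultrafilter_subset[OF \<xx> S] unfolding uf_mult_def by blast
  qed
  then have "uf_mult A \<XX> = \<xx>"
    using ultrafilter_eqI[OF \<xx> uf_mult_in_ultrafilters[OF \<XX>]] by simp
  moreover have "u \<le> U_ext K \<XX> (principal_uf B y)"
  proof (rule le_U_ext)
    fix \<S> T assume \<S>: "\<S> \<in> \<XX>" and T: "T \<in> principal_uf B y"
    \<comment> \<open>\<open>A\<^sup>\<sharp>\<close> consists of all ultrafilters on \<open>A\<close>, so this set is \<open>W\<close> itself.\<close>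
    have "sharp A A \<inter> W \<in> \<XX>" using base ultrafilter_carrier[OF \<xx>] by blast
    then have "\<S> \<inter> (sharp A A \<inter> W) \<noteq> {}"
      using \<S> ultrafilter_Int[OF \<XX>] ultrafilter_nonempty[OF \<XX>] by blast
    then show "\<exists>\<xx>'\<in>\<S>. \<exists>t\<in>T. u \<le> K \<xx>' t"
      using T unfolding W_def principal_uf_def by blast
  qed
  ultimately show ?thesis using that \<XX> by blast
qed

text \<open>The second hypothesis is right unitarity with \<open>K\<close> in the place of the structure \<open>\<alpha>\<close>. It is
  this law, once verified for the composites \<open>UJ \<odot> \<beta>\<close> and \<open>\<alpha> \<odot> J\<close>, that makes an inequality
  between averages pointwise.\<close>

corollary le_of_averaged_le:
  fixes H K :: "'a set set \<Rightarrow> 'b \<Rightarrow> 'v::completely_distributive_quantale"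
  assumes averaged: "\<And>S. S \<subseteq> A \<Longrightarrow> (SUP \<xx>\<in>sharp A S. H \<xx> y) \<le> (SUP \<xx>\<in>sharp A S. K \<xx> y)"
    and algebra: "\<And>\<XX>. \<XX> \<in> ultrafilters (ultrafilters A) \<Longrightarrow>
      U_ext K \<XX> (principal_uf B y) \<le> K (uf_mult A \<XX>) y"
    and \<xx>: "\<xx> \<in> ultrafilters A"
  shows "H \<xx> y \<le> K \<xx> y"
proof (rule le_if_totally_below_le)
  fix u assume "u \<lless> H \<xx> y"
  then obtain \<XX> where "\<XX> \<in> ultrafilters (ultrafilters A)" "uf_mult A \<XX> = \<xx>"
    "u \<le> U_ext K \<XX> (principal_uf B y)"
    using totally_below_U_ext_of_averaged[where H = H and K = K, OF averaged \<xx>] by blast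
  then show "u \<le> K \<xx> y" using algebra order_trans by blast
qed

lemma P_open_imp_U_open:
  fixes J :: "'a \<Rightarrow> 'b \<Rightarrow> 'v::completely_distributive_quantale"
  assumes unitary: "unitary B \<beta>"
    and functorial: "rel_eq (ultrafilters (ultrafilters A)) (ultrafilters B)
        (U_ext (rel_comp (ultrafilters B) (U_ext J) \<beta>))
        (rel_comp (ultrafilters (ultrafilters B)) (U_ext (U_ext J)) (U_ext \<beta>))"
    and "open": "P_open A (induced_preclosure A \<alpha>) B (induced_preclosure B \<beta>) J"
  shows "U_open A \<alpha> B \<beta> J"
  unfolding U_open_def rel_le_def
proof (intro ballI)
  fix \<xx> y assume \<xx>: "\<xx> \<in> ultrafilters A" and y: "y \<in> B"
  let ?K = "rel_comp (ultrafilters B) (U_ext J) \<beta>"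
  show "rel_comp A \<alpha> J \<xx> y \<le> ?K \<xx> y"
  proof (rule le_of_averaged_le[where H = "rel_comp A \<alpha> J" and K = ?K, OF _ _ \<xx>])
    show "(SUP \<xx>\<in>sharp A S. rel_comp A \<alpha> J \<xx> y) \<le> (SUP \<xx>\<in>sharp A S. ?K \<xx> y)" if "S \<subseteq> A" for S
      using "open" that y unfolding P_open_iff_averaged by blast
  next
    fix \<XX> assume \<XX>: "\<XX> \<in> ultrafilters (ultrafilters A)"
    have "U_ext ?K \<XX> (principal_uf B y) =
      rel_comp (ultrafilters (ultrafilters B)) (U_ext (U_ext J)) (U_ext \<beta>) \<XX> (principal_uf B y)"
      using functorial \<XX> principal_uf_in_ultrafilters[OF y] unfolding rel_eq_def by blast
    also have "\<dots> \<le> ?K (uf_mult A \<XX>) y"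
      unfolding rel_comp_def[of "ultrafilters (ultrafilters B)"]
    proof (rule SUP_least)
      fix \<YY> assume \<YY>: "\<YY> \<in> ultrafilters (ultrafilters B)"
      have "U_ext \<beta> \<YY> (principal_uf B y) \<le> \<beta> (uf_mult B \<YY>) y"
        using unitary \<YY> y unfolding unitary_def by blast
      then have "U_ext (U_ext J) \<XX> \<YY> * U_ext \<beta> \<YY> (principal_uf B y) \<le>
        U_ext J (uf_mult A \<XX>) (uf_mult B \<YY>) * \<beta> (uf_mult B \<YY>) y"
        by (rule quantale_mult_mono[OF U_ext_U_ext_le_uf_mult])
      also have "\<dots> \<le> ?K (uf_mult A \<XX>) y"
        by (rule rel_comp_upper) (rule uf_mult_in_ultrafilters[OF \<YY>])
      finally show "U_ext (U_ext J) \<XX> \<YY> * U_ext \<beta> \<YY> (principal_uf B y) \<le> ?K (uf_mult A \<XX>) y" .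
    qed
    finally show "U_ext ?K \<XX> (principal_uf B y) \<le> ?K (uf_mult A \<XX>) y" .
  qed
qed

lemma U_compact_P_closed_imp_U_closed:
  fixes J :: "'a \<Rightarrow> 'b \<Rightarrow> 'v::completely_distributive_quantale"
  assumes category: "UV_category A \<alpha>"
    and functorial: "rel_eq (ultrafilters (ultrafilters A)) (ultrafilters B)
        (U_ext (rel_comp A \<alpha> J)) (rel_comp (ultrafilters A) (U_ext \<alpha>) (U_ext J))"
    and compact: "U_compact A \<alpha> B J"
    and closed: "P_closed A (induced_preclosure A \<alpha>) B (induced_preclosure B \<beta>) J"
  shows "U_closed A \<alpha> B \<beta> J"
  unfolding U_closed_def rel_le_def
proof (intro ballI)
  fix \<xx> y assume \<xx>: "\<xx> \<in> ultrafilters A" and y: "y \<in> B"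
  let ?K = "rel_comp A \<alpha> J"
  show "rel_comp (ultrafilters B) (U_ext J) \<beta> \<xx> y \<le> ?K \<xx> y"
  proof (rule le_of_averaged_le[where H = "rel_comp (ultrafilters B) (U_ext J) \<beta>" and K = ?K, OF _ _ \<xx>])
    show "(SUP \<xx>\<in>sharp A S. rel_comp (ultrafilters B) (U_ext J) \<beta> \<xx> y) \<le>
      (SUP \<xx>\<in>sharp A S. ?K \<xx> y)" if "S \<subseteq> A" for S
      using closed that y unfolding P_closed_iff_averaged by blast
  next
    fix \<XX> assume \<XX>: "\<XX> \<in> ultrafilters (ultrafilters A)"
    have "U_ext ?K \<XX> (principal_uf B y) =
      rel_comp (ultrafilters A) (U_ext \<alpha>) (U_ext J) \<XX> (principal_uf B y)"
      using functorial \<XX> principal_uf_in_ultrafilters[OF y] unfolding rel_eq_def by blast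
    also have "\<dots> \<le> ?K (uf_mult A \<XX>) y"
      unfolding rel_comp_def[of "ultrafilters A"]
    proof (rule SUP_least)
      fix \<zz> assume \<zz>: "\<zz> \<in> ultrafilters A"
      have "U_ext \<alpha> \<XX> \<zz> * U_ext J \<zz> (principal_uf B y) \<le> U_ext \<alpha> \<XX> \<zz> * ?K \<zz> y"
        using compact \<zz> y unfolding U_compact_def by (intro quantale_mult_left_mono) blast
      also have "\<dots> = (SUP x\<in>A. U_ext \<alpha> \<XX> \<zz> * \<alpha> \<zz> x * J x y)"
        unfolding rel_comp_def mult_SUP by (simp add: mult.assoc)
      also have "\<dots> \<le> ?K (uf_mult A \<XX>) y"
      proof (rule SUP_least)
        fix x assume x: "x \<in> A"
        have "U_ext \<alpha> \<XX> \<zz> * \<alpha> \<zz> x \<le> rel_comp (ultrafilters A) (U_ext \<alpha>) \<alpha> \<XX> x"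
          using \<zz> by (rule rel_comp_upper)
        also have "\<dots> \<le> \<alpha> (uf_mult A \<XX>) x"
          using category \<XX> x unfolding UV_category_def by blast
        finally have "U_ext \<alpha> \<XX> \<zz> * \<alpha> \<zz> x * J x y \<le> \<alpha> (uf_mult A \<XX>) x * J x y"
          by (rule quantale_mult_right_mono)
        also have "\<dots> \<le> ?K (uf_mult A \<XX>) y" using x by (rule rel_comp_upper)
        finally show "U_ext \<alpha> \<XX> \<zz> * \<alpha> \<zz> x * J x y \<le> ?K (uf_mult A \<XX>) y" .
      qed
      finally show "U_ext \<alpha> \<XX> \<zz> * U_ext J \<zz> (principal_uf B y) \<le> ?K (uf_mult A \<XX>) y" .
    qed
    finally show "U_ext ?K \<XX> (principal_uf B y) \<le> ?K (uf_mult A \<XX>) y" .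
  qed
qed

section \<open>Open and closed relations of graphs and of preclosure spaces\<close>

theorem theorem6p5:
  fixes A :: "'a set" and \<alpha> :: "'a set set \<Rightarrow> 'a \<Rightarrow> 'v::completely_distributive_quantale"
    and B :: "'b set" and \<beta> :: "'b set set \<Rightarrow> 'b \<Rightarrow> 'v"
    and \<delta> :: "'a set \<Rightarrow> 'a \<Rightarrow> 'v" and \<zeta> :: "'b set \<Rightarrow> 'b \<Rightarrow> 'v"
    and J :: "'a \<Rightarrow> 'b \<Rightarrow> 'v"
  assumes "UV_graph A \<alpha>" and "UV_graph B \<beta>"
    and "\<delta> = induced_preclosure A \<alpha>" and "\<zeta> = induced_preclosure B \<beta>"
  shows "preclosure_space A \<delta> \<and> preclosure_space B \<zeta> \<and>
    (U_open A \<alpha> B \<beta> J \<longrightarrow> P_open A \<delta> B \<zeta> J) \<and>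
    (U_closed A \<alpha> B \<beta> J \<longrightarrow> U_compact A \<alpha> B J \<and> P_closed A \<delta> B \<zeta> J) \<and>
    (unitary B \<beta> \<and>
      rel_eq (ultrafilters (ultrafilters A)) (ultrafilters B)
        (U_ext (rel_comp (ultrafilters B) (U_ext J) \<beta>))
        (rel_comp (ultrafilters (ultrafilters B)) (U_ext (U_ext J)) (U_ext \<beta>)) \<longrightarrow>
      (P_open A \<delta> B \<zeta> J \<longrightarrow> U_open A \<alpha> B \<beta> J)) \<and>
    (UV_category A \<alpha> \<and>
      rel_eq (ultrafilters (ultrafilters A)) (ultrafilters B)
        (U_ext (rel_comp A \<alpha> J))
        (rel_comp (ultrafilters A) (U_ext \<alpha>) (U_ext J)) \<longrightarrow>
      (U_compact A \<alpha> B J \<and> P_closed A \<delta> B \<zeta> J \<longrightarrow> U_closed A \<alpha> B \<beta> J))"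
  unfolding assms(3,4)
  using preclosure_space_induced_preclosure[OF assms(1)]
    preclosure_space_induced_preclosure[OF assms(2)]
    U_open_imp_P_open[of A \<alpha> B \<beta> J] U_closed_imp_P_closed[of A \<alpha> B \<beta> J]
    U_closed_imp_U_compact[OF assms(2), of A \<alpha> J]
    P_open_imp_U_open[of B \<beta> A J \<alpha>] U_compact_P_closed_imp_U_closed[of A \<alpha> B J \<beta>]
  by blast

end
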